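(* When $\alpha=0.5$, the QCARE policy is equivalent to Gaussian Thompson Sampling: for every history of past actions and rewards, the two policies have the same conditional distribution of the next action $a(t)$.
   Context: Setting: $N$ arms $[N]=\{1,\dots,N\}$ with rewards in $[0,1]$; at each time $t$ an arm $a(t)$ is pulled and its reward $r_{a(t)}(t)$ is observed. QCARE. Let $k_i(t)=\sum_{\ell=1}^{t-1}\mathbb I\{a(\ell)=i\}$ and $\hat\mu_i(t)=\frac{1}{k_i(t)+1}\sum_{\ell\le t-1:\,a(\ell)=i} r_i(\ell)$. The QCARE policy with parameter $\alpha$ plays at each time $t$ the arm $a(t)=\arg\max_i\theta_i(t)$, where $\theta_i(t)=\hat\mu_i(t)+\frac{\epsilon_{it}}{(k_i(t)+1)^\alpha}$ and the $\epsilon_{it}$ are independent standard normal random variables (independent of the rewards). Gaussian Thompson Sampling. Initialize $k_i=0$, $\hat\mu_i=0$ for every arm. At each time $t$: sample $\theta_i(t)$ independently over $i$ from the normal distribution $\mathcal N\big(\hat\mu_i,\frac{1}{k_i+1}\big)$ (mean, variance); play $a(t)=\arg\max_i\theta_i(t)$ and observe the reward $r_t$; then update $\hat\mu_{a(t)}:=\frac{\hat\mu_{a(t)}(k_{a(t)}+1)+r_t}{k_{a(t)}+2}$ and $k_{a(t)}:=k_{a(t)}+1$. *)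

theory Defs
  imports "HOL-Probability.Probability"
begin

text \<open>Arms are the natural numbers \<open>1, \<dots>, N\<close>, times are the natural numbers \<open>t \<ge> 1\<close>.  The history
  available at time \<open>t\<close> maps each earlier time \<open>l \<in> {1..<t}\<close> to the pair of pulled arm and observed
  reward.\<close>

abbreviation arms :: "nat \<Rightarrow> nat set" where
  "arms N \<equiv> {1..N}"

abbreviation reward_space :: "real measure" where
  "reward_space \<equiv> restrict_space borel {0..1}"

definition history_space :: "nat \<Rightarrow> nat \<Rightarrow> (nat \<Rightarrow> nat \<times> real) measure" where
  "history_space N t = (\<Pi>\<^sub>M l\<in>{1..<t}. count_space (arms N) \<Otimes>\<^sub>M reward_space)"

definition history ::
  "(nat \<Rightarrow> nat \<Rightarrow> 'a \<Rightarrow> real) \<Rightarrow> (nat \<Rightarrow> 'a \<Rightarrow> nat) \<Rightarrow> nat \<Rightarrow> 'a \<Rightarrow> (nat \<Rightarrow> nat \<times> real)" where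
  "history r a t \<omega> = (\<lambda>l\<in>{1..<t}. (a l \<omega>, r (a l \<omega>) l \<omega>))"

text \<open>\<open>K\<close> is a (regular) conditional distribution of \<open>Y\<close> given \<open>X\<close>.\<close>

definition is_cond_dist ::
  "'a measure \<Rightarrow> 'b measure \<Rightarrow> ('a \<Rightarrow> 'b) \<Rightarrow> 'c measure \<Rightarrow> ('a \<Rightarrow> 'c) \<Rightarrow> ('b \<Rightarrow> 'c measure) \<Rightarrow> bool" where
  "is_cond_dist M S X T Y K \<longleftrightarrow>
     X \<in> M \<rightarrow>\<^sub>M S \<and> Y \<in> M \<rightarrow>\<^sub>M T \<and> K \<in> S \<rightarrow>\<^sub>M prob_algebra T \<and>
     (\<forall>A\<in>sets S. \<forall>B\<in>sets T.
        emeasure M {\<omega> \<in> space M. X \<omega> \<in> A \<and> Y \<omega> \<in> B} =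
        (\<integral>\<^sup>+x. emeasure (K x) B * indicator A x \<partial>distr M S X))"

definition normal_dist :: "real \<Rightarrow> real \<Rightarrow> real measure" where
  "normal_dist m v = density lborel (normal_density m (sqrt v))"


subsection \<open>QCARE\<close>

definition pulls :: "(nat \<Rightarrow> nat \<times> real) \<Rightarrow> nat \<Rightarrow> nat \<Rightarrow> nat" where
  "pulls h t i = (\<Sum>l\<in>{1..<t}. if fst (h l) = i then 1 else 0)"

definition mu_hat :: "(nat \<Rightarrow> nat \<times> real) \<Rightarrow> nat \<Rightarrow> nat \<Rightarrow> real" where
  "mu_hat h t i = 1 / (real (pulls h t i) + 1) * (\<Sum>l | l \<in> {1..<t} \<and> fst (h l) = i. snd (h l))"

definition qcare_theta ::
  "real \<Rightarrow> nat \<Rightarrow> (nat \<Rightarrow> nat \<times> real) \<Rightarrow> (nat \<Rightarrow> real) \<Rightarrow> nat \<Rightarrow> real" where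
  "qcare_theta \<alpha> t h e i = mu_hat h t i + e i / (real (pulls h t i) + 1) powr \<alpha>"

text \<open>The library's \<^const>\<open>arg_max_on\<close> breaks ties by a fixed choice depending only on the set of
  maximisers.  Ties have probability zero for both policies.\<close>

definition qcare_next :: "nat \<Rightarrow> real \<Rightarrow> nat \<Rightarrow> (nat \<Rightarrow> nat \<times> real) \<Rightarrow> nat measure" where
  "qcare_next N \<alpha> t h =
     distr (\<Pi>\<^sub>M i\<in>arms N. normal_dist 0 1) (count_space (arms N))
       (\<lambda>e. arg_max_on (qcare_theta \<alpha> t h e) (arms N))"

text \<open>\<open>r i t\<close> is the reward arm \<open>i\<close> yields if pulled at time \<open>t\<close>, \<open>\<epsilon> i t\<close> is the exploration noise and
  \<open>a t\<close> is the pulled arm.  The joint law of the rewards is arbitrary.\<close>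

definition qcare_run ::
  "'a measure \<Rightarrow> nat \<Rightarrow> real \<Rightarrow> (nat \<Rightarrow> nat \<Rightarrow> 'a \<Rightarrow> real) \<Rightarrow> (nat \<Rightarrow> nat \<Rightarrow> 'a \<Rightarrow> real) \<Rightarrow>
   (nat \<Rightarrow> 'a \<Rightarrow> nat) \<Rightarrow> bool" where
  "qcare_run M N \<alpha> r \<epsilon> a \<longleftrightarrow>
     prob_space M \<and>
     (\<forall>i\<in>arms N. \<forall>t\<ge>1. r i t \<in> M \<rightarrow>\<^sub>M reward_space) \<and>
     (\<forall>i\<in>arms N. \<forall>t\<ge>1. distributed M lborel (\<epsilon> i t) std_normal_density) \<and>
     prob_space.indep_vars M (\<lambda>_. borel) (\<lambda>(i, t). \<epsilon> i t) (arms N \<times> {1..}) \<and>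
     prob_space.indep_var M
       (\<Pi>\<^sub>M p\<in>arms N \<times> {1..}. borel) (\<lambda>\<omega>. \<lambda>(i, t)\<in>arms N \<times> {1..}. \<epsilon> i t \<omega>)
       (\<Pi>\<^sub>M p\<in>arms N \<times> {1..}. reward_space) (\<lambda>\<omega>. \<lambda>(i, t)\<in>arms N \<times> {1..}. r i t \<omega>) \<and>
     (\<forall>t\<ge>1. \<forall>\<omega>\<in>space M.
        a t \<omega> = arg_max_on (qcare_theta \<alpha> t (history r a t \<omega>) (\<lambda>i. \<epsilon> i t \<omega>)) (arms N))"


subsection \<open>Gaussian Thompson Sampling\<close>

text \<open>\<open>gts_state h n\<close> holds the algorithm's variables \<open>k\<close> and mean estimates after processing the
  first \<open>n\<close> pulls, so the variables in force at time \<open>t\<close> are \<open>gts_state h (t - 1)\<close>.\<close>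

primrec gts_state :: "(nat \<Rightarrow> nat \<times> real) \<Rightarrow> nat \<Rightarrow> (nat \<Rightarrow> nat) \<times> (nat \<Rightarrow> real)" where
  "gts_state h 0 = ((\<lambda>_. 0), (\<lambda>_. 0))"
| "gts_state h (Suc n) =
     (let (k, m) = gts_state h n; (i, x) = h (Suc n) in
        (k(i := k i + 1), m(i := (m i * (real (k i) + 1) + x) / (real (k i) + 2))))"

definition gts_sample :: "nat \<Rightarrow> nat \<Rightarrow> (nat \<Rightarrow> nat \<times> real) \<Rightarrow> (nat \<Rightarrow> real) measure" where
  "gts_sample N t h =
     (let (k, m) = gts_state h (t - 1) in
        \<Pi>\<^sub>M i\<in>arms N. normal_dist (m i) (1 / (real (k i) + 1)))"

definition gts_next :: "nat \<Rightarrow> nat \<Rightarrow> (nat \<Rightarrow> nat \<times> real) \<Rightarrow> nat measure" where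
  "gts_next N t h =
     distr (gts_sample N t h) (count_space (arms N)) (\<lambda>\<theta>. arg_max_on \<theta> (arms N))"

definition gts_run ::
  "'a measure \<Rightarrow> nat \<Rightarrow> (nat \<Rightarrow> nat \<Rightarrow> 'a \<Rightarrow> real) \<Rightarrow> (nat \<Rightarrow> nat \<Rightarrow> 'a \<Rightarrow> real) \<Rightarrow>
   (nat \<Rightarrow> 'a \<Rightarrow> nat) \<Rightarrow> bool" where
  "gts_run M N r \<theta> a \<longleftrightarrow>
     prob_space M \<and>
     (\<forall>i\<in>arms N. \<forall>t\<ge>1. r i t \<in> M \<rightarrow>\<^sub>M reward_space) \<and>
     (\<forall>t\<ge>1. is_cond_dist M (history_space N t) (history r a t)
        (\<Pi>\<^sub>M i\<in>arms N. borel) (\<lambda>\<omega>. \<lambda>i\<in>arms N. \<theta> i t \<omega>) (gts_sample N t)) \<and>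
     (\<forall>t\<ge>1. \<forall>\<omega>\<in>space M. a t \<omega> = arg_max_on (\<lambda>i. \<theta> i t \<omega>) (arms N))"

end

theory Submission
  imports Defs
begin

text \<open>For \<open>\<alpha> = 1/2\<close> the QCARE index is an affine image of independent standard normal variables, and
  its law given the history is the product of the normal laws with mean \<open>mu_hat\<close> and variance
  \<open>1 / (pulls + 1)\<close>, which is what Thompson Sampling draws from, as its incremental update computes
  exactly these two statistics.  For the conditional laws: the history at time \<open>t\<close> is a function of
  the rewards and of the noise before \<open>t\<close>, hence independent of the noise at time \<open>t\<close>, so that
  conditioning amounts to freezing the history.\<close>

section \<open>Measurability of the arg max over a finite index set\<close>

lemma arg_max_on_cong:
  assumes "\<And>i. i \<in> I \<Longrightarrow> f i = g i"
  shows "arg_max_on f I = arg_max_on g I"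
proof -
  have "is_arg_max f (\<lambda>x. x \<in> I) = is_arg_max g (\<lambda>x. x \<in> I)"
    using assms by (auto simp: is_arg_max_def fun_eq_iff)
  then show ?thesis
    by (simp add: arg_max_on_def arg_max_def)
qed

lemma arg_max_on_restrict [simp]: "arg_max_on (restrict f I) I = arg_max_on f I"
  by (rule arg_max_on_cong) simp

text \<open>The selected arm is a function of the set of maximisers, which takes finitely many values.\<close>

lemma measurable_arg_max_on:
  assumes fin: "finite I" and "I \<noteq> {}"
  shows "(\<lambda>x :: 'i \<Rightarrow> real. arg_max_on x I) \<in> (\<Pi>\<^sub>M i\<in>I. borel) \<rightarrow>\<^sub>M count_space I"
proof -
  define P where "P = Pow I - {{}}"
  define F where "F = (\<lambda>x :: 'i \<Rightarrow> real. {j \<in> I. \<forall>k\<in>I. x k \<le> x j})"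
  \<comment> \<open>A maximiser must exist for \<open>SOME j. j \<in> F x\<close> to land in
    \<open>I\<close>; the finite maximum supplies one.\<close>
  have ne: "F x \<noteq> {}" for x
  proof -
    have "Max (x ` I) \<in> x ` I"
      using assms by simp
    then obtain j where "j \<in> I" "x j = Max (x ` I)"
      by auto
    then have "j \<in> F x"
      using fin by (simp add: F_def)
    then show ?thesis by blast
  qed
  have [measurable]: "Measurable.pred (\<Pi>\<^sub>M i\<in>I. borel) (\<lambda>x :: 'i \<Rightarrow> real. x k \<le> x j)"
    if "j \<in> I" "k \<in> I" for j k
    using borel_measurable_le[OF measurable_component_singleton[OF that(2)]
        measurable_component_singleton[OF that(1)]]
    by (simp add: pred_def)
  have "finite P"
    using fin by (simp add: P_def)
  moreover have "F x \<in> P" for x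
    using ne[of x] by (auto simp: P_def F_def)
  moreover have "F -` {S} \<inter> space (\<Pi>\<^sub>M i\<in>I. borel) \<in> sets (\<Pi>\<^sub>M i\<in>I. borel)" if "S \<in> P" for S
  proof -
    \<comment> \<open>As \<open>S\<close> is a subset of \<open>I\<close>, the event that
      \<open>F x\<close> equals \<open>S\<close> is a finite Boolean combination of comparisons of
      two coordinates.\<close>
    have "F -` {S} \<inter> space (\<Pi>\<^sub>M i\<in>I. borel) =
        {x \<in> space (\<Pi>\<^sub>M i\<in>I. borel). \<forall>j\<in>I. j \<in> S \<longleftrightarrow> (\<forall>k\<in>I. x k \<le> x j)}"
      using that by (auto simp: F_def P_def)
    also have "\<dots> \<in> sets (\<Pi>\<^sub>M i\<in>I. borel)"
      using fin by measurable
    finally show ?thesis .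
  qed
  ultimately have "F \<in> (\<Pi>\<^sub>M i\<in>I. borel) \<rightarrow>\<^sub>M count_space P"
    by (subst measurable_count_space_eq2) blast+
  moreover have "(SOME j. j \<in> S) \<in> I" if "S \<in> P" for S
    using that some_in_eq[of S] unfolding P_def by blast
  then have "(\<lambda>S. SOME j. j \<in> S) \<in> count_space P \<rightarrow>\<^sub>M count_space I"
    by simp
  ultimately have "(\<lambda>x. SOME j. j \<in> F x) \<in> (\<Pi>\<^sub>M i\<in>I. borel) \<rightarrow>\<^sub>M count_space I"
    by (rule measurable_compose)
  moreover have "arg_max_on x I = (SOME j. j \<in> F x)" for x :: "'i \<Rightarrow> real"
    unfolding arg_max_on_def arg_max_def is_arg_max_linorder F_def Ball_def mem_Collect_eq ..
  ultimately show ?thesis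
    by simp
qed

section \<open>Normal laws, and the two laws of the next arm for a fixed history\<close>

lemma prob_space_normal_dist:
  assumes "v > 0"
  shows "prob_space (normal_dist m v)"
  unfolding normal_dist_def using assms by (intro prob_space_normal_density) simp

lemma sets_normal_dist [simp, measurable_cong]: "sets (normal_dist m v) = sets borel"
  by (simp add: normal_dist_def)

lemma space_normal_dist [simp]: "space (normal_dist m v) = UNIV"
  by (simp add: normal_dist_def)

lemma distr_standard_normal:
  assumes "v > 0"
  shows "distr (normal_dist 0 1) borel (\<lambda>x. m + sqrt v * x) = normal_dist m v"
proof -
  interpret prob_space "normal_dist 0 1"
    by (rule prob_space_normal_dist) simp
  \<comment> \<open>The fact on affine images speaks of random variables, so the normal law is
    presented as the law of the identity on its own space.\<close>
  have "distributed (normal_dist 0 1) lborel (\<lambda>x. x) (normal_density 0 1)"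
    unfolding distributed_def by (auto simp: normal_dist_def distr_id2 cong: distr_cong)
  from normal_density_affine[OF this, of "sqrt v" m] assms
  have "distributed (normal_dist 0 1) lborel (\<lambda>x. m + sqrt v * x) (normal_density m (sqrt v))"
    by simp
  then have "distr (normal_dist 0 1) lborel (\<lambda>x. m + sqrt v * x) = normal_dist m v"
    by (simp add: normal_dist_def distributed_def)
  then show ?thesis
    by (simp cong: distr_cong)
qed

text \<open>A finite product measure is determined by its values on boxes. A map acting
  coordinatewise pulls boxes back to boxes, so the claim reduces to
  \<open>distr_standard_normal\<close> in each factor.\<close>

lemma distr_PiM_standard_normal:
  assumes fin: "finite I" and v: "\<And>i. v i > 0"
  shows "distr (\<Pi>\<^sub>M i\<in>I. normal_dist 0 1) (\<Pi>\<^sub>M i\<in>I. borel) (\<lambda>e. \<lambda>i\<in>I. m i + sqrt (v i) * e i) =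
    (\<Pi>\<^sub>M i\<in>I. normal_dist (m i) (v i))"
proof -
  interpret Z: product_prob_space "\<lambda>_. normal_dist 0 1" I
    by (intro product_prob_spaceI prob_space_normal_dist) simp
  interpret product_prob_space "\<lambda>i. normal_dist (m i) (v i)" I
    using v by (intro product_prob_spaceI prob_space_normal_dist)
  let ?f = "\<lambda>e. \<lambda>i\<in>I. m i + sqrt (v i) * e i"
  have f: "?f \<in> (\<Pi>\<^sub>M i\<in>I. normal_dist 0 1) \<rightarrow>\<^sub>M (\<Pi>\<^sub>M i\<in>I. borel)"
    by measurable
  show ?thesis
  proof (rule PiM_eqI[OF fin])
    show "sets (distr (\<Pi>\<^sub>M i\<in>I. normal_dist 0 1) (\<Pi>\<^sub>M i\<in>I. borel) ?f) =
        sets (\<Pi>\<^sub>M i\<in>I. normal_dist (m i) (v i))"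
      unfolding sets_distr by (rule sets_PiM_cong) simp_all
  next
    fix A assume "\<And>i. i \<in> I \<Longrightarrow> A i \<in> sets (normal_dist (m i) (v i))"
    then have A: "\<And>i. i \<in> I \<Longrightarrow> A i \<in> sets borel"
      by simp
    have pre: "(\<lambda>x. m i + sqrt (v i) * x) -` A i \<in> sets borel" if "i \<in> I" for i
      using measurable_sets[of "\<lambda>x. m i + sqrt (v i) * x" borel borel "A i"] A[OF that] by simp
    have "emeasure (distr (\<Pi>\<^sub>M i\<in>I. normal_dist 0 1) (\<Pi>\<^sub>M i\<in>I. borel) ?f) (Pi\<^sub>E I A) =
        emeasure (\<Pi>\<^sub>M i\<in>I. normal_dist 0 1)
          (?f -` Pi\<^sub>E I A \<inter> space (\<Pi>\<^sub>M i\<in>I. normal_dist 0 1))"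
      by (intro emeasure_distr f sets_PiM_I_finite fin A)
    also have "?f -` Pi\<^sub>E I A \<inter> space (\<Pi>\<^sub>M i\<in>I. normal_dist 0 1) =
        (\<Pi>\<^sub>E i\<in>I. (\<lambda>x. m i + sqrt (v i) * x) -` A i)"
      by (auto simp: space_PiM PiE_iff)
    also have "emeasure (\<Pi>\<^sub>M i\<in>I. normal_dist 0 1) \<dots> =
        (\<Prod>i\<in>I. emeasure (normal_dist 0 1) ((\<lambda>x. m i + sqrt (v i) * x) -` A i))"
      by (intro Z.emeasure_PiM fin) (simp add: pre)
    also have "\<dots> = (\<Prod>i\<in>I. emeasure (normal_dist (m i) (v i)) (A i))"
    proof (intro prod.cong refl)
      fix i assume "i \<in> I"
      then show "emeasure (normal_dist 0 1) ((\<lambda>x. m i + sqrt (v i) * x) -` A i) =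
          emeasure (normal_dist (m i) (v i)) (A i)"
        using emeasure_distr[of "\<lambda>x. m i + sqrt (v i) * x" "normal_dist 0 1" borel "A i"] A v
        by (simp add: distr_standard_normal)
    qed
    finally show "emeasure (distr (\<Pi>\<^sub>M i\<in>I. normal_dist 0 1) (\<Pi>\<^sub>M i\<in>I. borel) ?f) (Pi\<^sub>E I A) =
        (\<Prod>i\<in>I. emeasure (normal_dist (m i) (v i)) (A i))" .
  qed
qed

text \<open>Induction on the number of pulls; the state after \<open>n\<close> pulls is the one in
  force at time \<open>Suc n\<close>. Since \<open>mu_hat\<close> divides by the count plus one,
  multiplying by \<open>k + 1\<close> recovers the sum of rewards exactly, and the update adds the
  new reward before dividing by the new count plus one.\<close>

lemma gts_state_eq: "gts_state h n = (pulls h (Suc n), mu_hat h (Suc n))"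
proof (induction n)
  case 0
  show ?case
    by (simp add: pulls_def mu_hat_def fun_eq_iff)
next
  case (Suc n)
  obtain j x where jx: "h (Suc n) = (j, x)"
    by fastforce
  have k: "pulls h (Suc (Suc n)) i = pulls h (Suc n) i + (if i = j then 1 else 0)" for i
    by (auto simp: pulls_def jx)
  define s where "s = (\<lambda>t i. \<Sum>l | l \<in> {1..<t} \<and> fst (h l) = i. snd (h l))"
  \<comment> \<open>Only the arm \<open>j\<close> pulled at time \<open>Suc n\<close> gains an index
    in its reward sum.\<close>
  have "{l \<in> {1..<Suc (Suc n)}. fst (h l) = i} =
      (if i = j then insert (Suc n) else id) {l \<in> {1..<Suc n}. fst (h l) = i}" for i
    using jx by (auto simp: less_Suc_eq)
  then have s: "s (Suc (Suc n)) i = s (Suc n) i + (if i = j then x else 0)" for i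
    by (simp only: s_def) (simp add: jx)
  have mu: "mu_hat h t i = s t i / (real (pulls h t i) + 1)" for t i
    by (simp add: mu_hat_def s_def)
  have "real (pulls h (Suc n) j) + 1 \<noteq> 0"
    by linarith
  then have "(pulls h (Suc n))(j := pulls h (Suc n) j + 1) = pulls h (Suc (Suc n))"
    and "(mu_hat h (Suc n))(j := (mu_hat h (Suc n) j * (real (pulls h (Suc n) j) + 1) + x) /
      (real (pulls h (Suc n) j) + 2)) = mu_hat h (Suc (Suc n))"
    by (simp_all only: fun_eq_iff fun_upd_apply k mu s) (simp_all add: add.commute)
  then show ?case
    by (simp only: gts_state.simps Suc jx Let_def prod.case)
qed

text \<open>At exponent 1/2 the noise is scaled by the standard deviation of the Thompson sample, so
  the index vector restricted to the arms has law \<open>gts_sample\<close>. Both policies apply the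
  same \<open>arg_max_on\<close>, hence ties need no separate argument.\<close>

lemma qcare_next_eq_gts_next:
  assumes "N \<ge> 1" and "t \<ge> 1"
  shows "qcare_next N (1/2) t h = gts_next N t h"
proof -
  let ?v = "\<lambda>i. 1 / (real (pulls h t i) + 1)"
  let ?f = "\<lambda>e. \<lambda>i\<in>arms N. mu_hat h t i + sqrt (?v i) * e i"
  have "gts_sample N t h = (\<Pi>\<^sub>M i\<in>arms N. normal_dist (mu_hat h t i) (?v i))"
    \<comment> \<open>Here \<open>t \<ge> 1\<close> ensures that \<open>Suc (t - 1)\<close> is
      \<open>t\<close>.\<close>
    using assms by (simp add: gts_sample_def gts_state_eq)
  also have "\<dots> = distr (\<Pi>\<^sub>M i\<in>arms N. normal_dist 0 1) (\<Pi>\<^sub>M i\<in>arms N. borel) ?f"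
    by (intro distr_PiM_standard_normal[symmetric]) (auto simp: add_nonneg_pos)
  finally have "gts_next N t h = distr (distr (\<Pi>\<^sub>M i\<in>arms N. normal_dist 0 1) (\<Pi>\<^sub>M i\<in>arms N. borel) ?f)
      (count_space (arms N)) (\<lambda>\<theta>. arg_max_on \<theta> (arms N))"
    by (simp add: gts_next_def)
  also have "\<dots> = distr (\<Pi>\<^sub>M i\<in>arms N. normal_dist 0 1) (count_space (arms N))
      ((\<lambda>\<theta>. arg_max_on \<theta> (arms N)) \<circ> ?f)"
    using assms by (intro distr_distr measurable_arg_max_on) (auto intro!: measurable_restrict)
  \<comment> \<open>The maximum ranges over \<open>arms N\<close> only, so the default value of
    \<open>?f\<close> off the arms is harmless.\<close>
  also have "(\<lambda>\<theta>. arg_max_on \<theta> (arms N)) \<circ> ?f = (\<lambda>e. arg_max_on (qcare_theta (1/2) t h e) (arms N))"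
    by (auto simp: fun_eq_iff qcare_theta_def powr_half_sqrt real_sqrt_divide
        intro!: arg_max_on_cong)
  finally show ?thesis
    by (simp add: qcare_next_def)
qed

section \<open>Measurability of the statistics and of the history\<close>

lemma measurable_history_component:
  assumes "l \<in> {1..<t}"
  shows "(\<lambda>h. h l) \<in> history_space N t \<rightarrow>\<^sub>M count_space (arms N) \<Otimes>\<^sub>M reward_space"
  unfolding history_space_def using assms by (rule measurable_component_singleton)

lemma measurable_pulls:
  "(\<lambda>h. real (pulls h t i)) \<in> borel_measurable (history_space N t)"
proof -
  have "(\<lambda>p. if fst p = i then 1 else 0 :: real) \<in>
      borel_measurable (count_space (arms N) \<Otimes>\<^sub>M reward_space)"
    by measurable
  from measurable_compose[OF measurable_history_component this]
  have "(\<lambda>h. \<Sum>l\<in>{1..<t}. if fst (h l) = i then 1 else 0 :: real) \<in>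
      borel_measurable (history_space N t)"
    by (rule borel_measurable_sum)
  also have "(\<lambda>h. \<Sum>l\<in>{1..<t}. if fst (h l) = i then 1 else 0 :: real) = (\<lambda>h. real (pulls h t i))"
    unfolding pulls_def of_nat_sum by (intro ext sum.cong) auto
  finally show ?thesis .
qed

lemma measurable_mu_hat:
  "(\<lambda>h. mu_hat h t i) \<in> borel_measurable (history_space N t)"
proof -
  have "(\<lambda>x. x) \<in> borel_measurable reward_space"
    by (rule measurable_restrict_space1) simp
  from measurable_compose[OF measurable_snd this]
  have [measurable]: "snd \<in> borel_measurable (count_space (arms N) \<Otimes>\<^sub>M reward_space)"
    by simp
  \<comment> \<open>The index set of the sum in \<open>mu_hat\<close> depends on the history;
    summing over all earlier times with zeros for the other arms makes it fixed.\<close>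
  have "(\<lambda>p. if fst p = i then snd p else 0) \<in>
      borel_measurable (count_space (arms N) \<Otimes>\<^sub>M reward_space)"
    by measurable
  from measurable_compose[OF measurable_history_component this]
  have [measurable]: "(\<lambda>h. \<Sum>l\<in>{1..<t}. if fst (h l) = i then snd (h l) else 0) \<in>
      borel_measurable (history_space N t)"
    by (rule borel_measurable_sum)
  note measurable_pulls [measurable]
  have "(\<lambda>h. 1 / (real (pulls h t i) + 1) * (\<Sum>l\<in>{1..<t}. if fst (h l) = i then snd (h l) else 0)) \<in>
      borel_measurable (history_space N t)"
    by measurable
  then show ?thesis
    unfolding mu_hat_def sum.inter_filter[OF finite_atLeastLessThan] .
qed

text \<open>Joint measurability in history and noise serves twice: it makes the pulled arm
  measurable along a run, and it makes the law of the next arm a measurable kernel in the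
  history.\<close>

lemma measurable_qcare_arm:
  assumes "N \<ge> 1"
  shows "(\<lambda>(h, e). arg_max_on (qcare_theta \<alpha> t h e) (arms N)) \<in>
    history_space N t \<Otimes>\<^sub>M (\<Pi>\<^sub>M i\<in>arms N. borel) \<rightarrow>\<^sub>M count_space (arms N)"
proof -
  note [measurable] = measurable_pulls measurable_mu_hat
  have "(\<lambda>(h, e). \<lambda>i\<in>arms N. qcare_theta \<alpha> t h e i) \<in>
      history_space N t \<Otimes>\<^sub>M (\<Pi>\<^sub>M i\<in>arms N. borel) \<rightarrow>\<^sub>M (\<Pi>\<^sub>M i\<in>arms N. borel)"
    unfolding qcare_theta_def by measurable
  from measurable_compose[OF this measurable_arg_max_on] assms
  show ?thesis
    by (simp add: case_prod_beta')
qed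

lemma arg_max_on_qcare_theta_restrict:
  "arg_max_on (qcare_theta \<alpha> t h (restrict e (arms N))) (arms N) =
    arg_max_on (qcare_theta \<alpha> t h e) (arms N)"
  by (rule arg_max_on_cong) (simp add: qcare_theta_def)

text \<open>Strong induction on time: the arm at \<open>l\<close> is a function of the history
  before \<open>l\<close> and of the noise at \<open>l\<close>. The measure \<open>M\<close> is
  arbitrary and only rewards and noise before \<open>t\<close> must be measurable, so the lemma also
  applies to a smaller sigma-algebra carrying just that information.\<close>

lemma measurable_history:
  assumes N: "N \<ge> 1"
    and r: "\<And>i l. i \<in> arms N \<Longrightarrow> l \<in> {1..<t} \<Longrightarrow> r i l \<in> M \<rightarrow>\<^sub>M reward_space"
    and \<epsilon>: "\<And>i l. i \<in> arms N \<Longrightarrow> l \<in> {1..<t} \<Longrightarrow> \<epsilon> i l \<in> borel_measurable M"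
    and a: "\<And>l \<omega>. l \<ge> 1 \<Longrightarrow> \<omega> \<in> space M \<Longrightarrow>
      a l \<omega> = arg_max_on (qcare_theta \<alpha> l (history r a l \<omega>) (\<lambda>i. \<epsilon> i l \<omega>)) (arms N)"
  shows "history r a t \<in> M \<rightarrow>\<^sub>M history_space N t"
  using r \<epsilon>
proof (induction t rule: less_induct)
  case (less t)
  have "(\<lambda>\<omega>. (a l \<omega>, r (a l \<omega>) l \<omega>)) \<in> M \<rightarrow>\<^sub>M count_space (arms N) \<Otimes>\<^sub>M reward_space"
    if l: "l \<in> {1..<t}" for l
  proof -
    have "history r a l \<in> M \<rightarrow>\<^sub>M history_space N l"
      using l by (intro less) auto
    moreover have "(\<lambda>\<omega>. \<lambda>i\<in>arms N. \<epsilon> i l \<omega>) \<in> M \<rightarrow>\<^sub>M (\<Pi>\<^sub>M i\<in>arms N. borel)"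
      using l less by (intro measurable_restrict) auto
    ultimately have "(\<lambda>\<omega>. (history r a l \<omega>, \<lambda>i\<in>arms N. \<epsilon> i l \<omega>)) \<in>
        M \<rightarrow>\<^sub>M history_space N l \<Otimes>\<^sub>M (\<Pi>\<^sub>M i\<in>arms N. borel)"
      by (rule measurable_Pair)
    from measurable_compose[OF this measurable_qcare_arm[OF N]]
    have "(\<lambda>\<omega>. arg_max_on (qcare_theta \<alpha> l (history r a l \<omega>) (\<lambda>i. \<epsilon> i l \<omega>)) (arms N)) \<in>
        M \<rightarrow>\<^sub>M count_space (arms N)"
      by (simp only: prod.case arg_max_on_qcare_theta_restrict)
    moreover have "l \<ge> 1"
      using l by simp
    ultimately have al: "a l \<in> M \<rightarrow>\<^sub>M count_space (arms N)"
      by (subst measurable_cong[OF a])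
    \<comment> \<open>The index is random but takes countably many values, so the observed reward is
      pieced together from the measurable \<open>r i l\<close>.\<close>
    have "(\<lambda>\<omega>. r (a l \<omega>) l \<omega>) \<in> M \<rightarrow>\<^sub>M reward_space"
      by (rule measurable_compose_countable'[OF less(2)[OF _ l] al]) simp_all
    with al show ?thesis
      by (rule measurable_Pair)
  qed
  then show ?case
    unfolding history_def history_space_def by (rule measurable_restrict)
qed

section \<open>Independence and conditional distributions\<close>

lemma sets_vimage_algebra_subset:
  assumes "f \<in> M \<rightarrow>\<^sub>M N"
  shows "sets (vimage_algebra (space M) f N) \<subseteq> sets M"
  unfolding sets_vimage_algebra
  using measurable_sets[OF assms] by (intro sets.sigma_sets_subset) auto

text \<open>The two measures agree on rectangles, where independence of the generated sigma-algebras
  is exactly the product formula.\<close>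

lemma (in prob_space) distr_Pair_indep_set:
  assumes ind: "indep_set (sets (vimage_algebra (space M) X S)) (sets (vimage_algebra (space M) Y T))"
    and X: "X \<in> M \<rightarrow>\<^sub>M S" and Y: "Y \<in> M \<rightarrow>\<^sub>M T"
  shows "distr M S X \<Otimes>\<^sub>M distr M T Y = distr M (S \<Otimes>\<^sub>M T) (\<lambda>\<omega>. (X \<omega>, Y \<omega>))"
proof (rule pair_measure_eqI)
  note [measurable] = X Y
  show "sigma_finite_measure (distr M S X)" "sigma_finite_measure (distr M T Y)"
    using prob_space_distr[OF X] prob_space_distr[OF Y] by (simp_all add: prob_space_imp_sigma_finite)
  show "sets (distr M S X \<Otimes>\<^sub>M distr M T Y) = sets (distr M (S \<Otimes>\<^sub>M T) (\<lambda>\<omega>. (X \<omega>, Y \<omega>)))"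
    unfolding sets_distr by (intro sets_pair_measure_cong) simp_all
  fix A B assume "A \<in> sets (distr M S X)" "B \<in> sets (distr M T Y)"
  then have A: "A \<in> sets S" and B: "B \<in> sets T"
    by simp_all
  have "prob ((X -` A \<inter> space M) \<inter> (Y -` B \<inter> space M)) =
      prob (X -` A \<inter> space M) * prob (Y -` B \<inter> space M)"
    using ind A B by (auto intro!: indep_setD in_vimage_algebra)
  moreover have "(\<lambda>\<omega>. (X \<omega>, Y \<omega>)) -` (A \<times> B) \<inter> space M =
      (X -` A \<inter> space M) \<inter> (Y -` B \<inter> space M)"
    by auto
  ultimately show "emeasure (distr M S X) A * emeasure (distr M T Y) B =
      emeasure (distr M (S \<Otimes>\<^sub>M T) (\<lambda>\<omega>. (X \<omega>, Y \<omega>))) (A \<times> B)"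
    using A B by (simp add: emeasure_distr emeasure_eq_measure ennreal_mult[symmetric])
qed

text \<open>For events a, b, c of the three families, P(a b c) = P(a b) P(c) = P(a) P(b) P(c) = P(a)
  P(b c). The family \<open>G\<close> has to contain the intersections a b, since independence of
  \<open>C\<close> from \<open>A\<close> and from \<open>B\<close> separately would not give the
  first equality. The sets b c are stable under intersection, so the formula extends to the
  generated sigma-algebras.\<close>

lemma (in prob_space) indep_set_sigma_sets_Int:
  assumes stable: "Int_stable A" "Int_stable B" "Int_stable C"
    and AB: "indep_set A B" and GC: "indep_set G C"
    and G: "\<And>a b. a \<in> A \<Longrightarrow> b \<in> B \<Longrightarrow> a \<inter> b \<in> G" "B \<subseteq> G"
  shows "indep_set (sigma_sets (space M) A) (sigma_sets (space M) {b \<inter> c |b c. b \<in> B \<and> c \<in> C})"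
proof (rule indep_set_sigma_sets)
  have ev: "A \<subseteq> events" "B \<subseteq> events" "C \<subseteq> events"
    using AB GC by (auto simp: indep_sets2_eq)
  show "indep_set A {b \<inter> c |b c. b \<in> B \<and> c \<in> C}"
  proof (rule indep_setI)
    show "{b \<inter> c |b c. b \<in> B \<and> c \<in> C} \<subseteq> events"
      using ev by auto
    fix a d assume a: "a \<in> A" and "d \<in> {b \<inter> c |b c. b \<in> B \<and> c \<in> C}"
    then obtain b c where b: "b \<in> B" and c: "c \<in> C" and d: "d = b \<inter> c"
      by auto
    have "prob (a \<inter> d) = prob ((a \<inter> b) \<inter> c)"
      by (simp add: d Int_assoc)
    also have "\<dots> = prob (a \<inter> b) * prob c"
      using GC G(1)[OF a b] c by (rule indep_setD)
    also have "\<dots> = prob a * (prob b * prob c)"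
      using indep_setD[OF AB a b] by simp
    also have "prob b * prob c = prob d"
      using indep_setD[OF GC _ c, of b] G(2) b by (auto simp: d)
    finally show "prob (a \<inter> d) = prob a * prob d" .
  qed (use ev in auto)
  show "Int_stable {b \<inter> c |b c. b \<in> B \<and> c \<in> C}"
  proof (rule Int_stableI)
    fix d d' assume "d \<in> {b \<inter> c |b c. b \<in> B \<and> c \<in> C}" "d' \<in> {b \<inter> c |b c. b \<in> B \<and> c \<in> C}"
    then obtain b c b' c' where "b \<in> B" "c \<in> C" "d = b \<inter> c" "b' \<in> B" "c' \<in> C" "d' = b' \<inter> c'"
      by auto
    then have "d \<inter> d' = (b \<inter> b') \<inter> (c \<inter> c')" "b \<inter> b' \<in> B" "c \<inter> c' \<in> C"
      using stable by (auto simp: Int_stable_def)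
    then show "d \<inter> d' \<in> {b \<inter> c |b c. b \<in> B \<and> c \<in> C}"
      by blast
  qed
qed (rule stable)

text \<open>Freezing: when the joint law of \<open>X\<close> and \<open>W\<close> is a product, the
  probability of the event is the integral of the \<open>W\<close>-measures of its sections, and in
  the section at x the first argument of \<open>g\<close> is the constant x.\<close>

lemma (in prob_space) is_cond_dist_indep:
  assumes X [measurable]: "X \<in> M \<rightarrow>\<^sub>M S" and W [measurable]: "W \<in> M \<rightarrow>\<^sub>M E"
    and ind: "distr M S X \<Otimes>\<^sub>M distr M E W = distr M (S \<Otimes>\<^sub>M E) (\<lambda>\<omega>. (X \<omega>, W \<omega>))"
    and g: "(\<lambda>(x, e). g x e) \<in> S \<Otimes>\<^sub>M E \<rightarrow>\<^sub>M T"
    and Y: "\<And>\<omega>. \<omega> \<in> space M \<Longrightarrow> Y \<omega> = g (X \<omega>) (W \<omega>)"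
  shows "is_cond_dist M S X T Y (\<lambda>x. distr (distr M E W) T (g x))"
  unfolding is_cond_dist_def
proof (intro conjI ballI)
  show "X \<in> M \<rightarrow>\<^sub>M S"
    by (rule X)
  have XW: "(\<lambda>\<omega>. (X \<omega>, W \<omega>)) \<in> M \<rightarrow>\<^sub>M S \<Otimes>\<^sub>M E"
    by measurable
  have "(\<lambda>\<omega>. g (X \<omega>) (W \<omega>)) \<in> M \<rightarrow>\<^sub>M T"
    using measurable_compose[OF XW g] by simp
  then show "Y \<in> M \<rightarrow>\<^sub>M T"
    by (subst measurable_cong[OF Y])
  interpret W: prob_space "distr M E W"
    using W by (rule prob_space_distr)
  have "distr M E W \<in> space (prob_algebra E)"
    using W.prob_space_axioms by (simp add: space_prob_algebra)
  then show "(\<lambda>x. distr (distr M E W) T (g x)) \<in> S \<rightarrow>\<^sub>M prob_algebra T"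
    by (intro measurable_distr_prob_space2[OF _ g] measurable_const)
  fix A B assume A: "A \<in> sets S" and B: "B \<in> sets T"
  define Q where "Q = (A \<times> space E) \<inter> ((\<lambda>(x, e). g x e) -` B \<inter> space (S \<Otimes>\<^sub>M E))"
  have Q: "Q \<in> sets (S \<Otimes>\<^sub>M E)"
    unfolding Q_def by (intro sets.Int[OF _ measurable_sets[OF g B]] pair_measureI A sets.top)
  have "emeasure M {\<omega> \<in> space M. X \<omega> \<in> A \<and> Y \<omega> \<in> B} =
      emeasure (distr M (S \<Otimes>\<^sub>M E) (\<lambda>\<omega>. (X \<omega>, W \<omega>))) Q"
    unfolding emeasure_distr[OF XW Q] unfolding Q_def
    using Y measurable_space[OF X] measurable_space[OF W]
    by (intro arg_cong[where f = "emeasure M"]) (auto simp: space_pair_measure)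
  also have "\<dots> = emeasure (distr M S X \<Otimes>\<^sub>M distr M E W) Q"
    by (simp only: ind)
  also have "\<dots> = (\<integral>\<^sup>+x. emeasure (distr M E W) (Pair x -` Q) \<partial>distr M S X)"
    using Q by (intro W.emeasure_pair_measure_alt) simp
  also have "\<dots> = (\<integral>\<^sup>+x. emeasure (distr (distr M E W) T (g x)) B * indicator A x \<partial>distr M S X)"
  proof (rule nn_integral_cong)
    fix x assume "x \<in> space (distr M S X)"
    then have x: "x \<in> space S"
      by simp
    have gx: "g x \<in> distr M E W \<rightarrow>\<^sub>M T"
      using measurable_compose[OF measurable_Pair1'[OF x] g] by simp
    have "Pair x -` Q = (if x \<in> A then g x -` B \<inter> space E else {})"
      using x by (auto simp: Q_def space_pair_measure)
    then show "emeasure (distr M E W) (Pair x -` Q) =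
        emeasure (distr (distr M E W) T (g x)) B * indicator A x"
      by (simp add: emeasure_distr[OF gx B])
  qed
  finally show "emeasure M {\<omega> \<in> space M. X \<omega> \<in> A \<and> Y \<omega> \<in> B} =
      (\<integral>\<^sup>+x. emeasure (distr (distr M E W) T (g x)) B * indicator A x \<partial>distr M S X)" .
qed

text \<open>Conditional laws push forward, because \<open>Z\<close> lies in \<open>B\<close> exactly
  when \<open>Y\<close> lies in the preimage of \<open>B\<close> under \<open>f\<close>.\<close>

lemma is_cond_dist_compose:
  assumes K: "is_cond_dist M S X T Y K"
    and f: "f \<in> T \<rightarrow>\<^sub>M U"
    and Z: "\<And>\<omega>. \<omega> \<in> space M \<Longrightarrow> Z \<omega> = f (Y \<omega>)"
  shows "is_cond_dist M S X U Z (\<lambda>x. distr (K x) U f)"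
  unfolding is_cond_dist_def
proof (intro conjI ballI)
  show X: "X \<in> M \<rightarrow>\<^sub>M S"
    using K by (simp add: is_cond_dist_def)
  have Y: "Y \<in> M \<rightarrow>\<^sub>M T" and Km: "K \<in> S \<rightarrow>\<^sub>M prob_algebra T"
    using K by (simp_all add: is_cond_dist_def)
  show "Z \<in> M \<rightarrow>\<^sub>M U"
    using measurable_compose[OF Y f] by (subst measurable_cong[OF Z])
  show "(\<lambda>x. distr (K x) U f) \<in> S \<rightarrow>\<^sub>M prob_algebra U"
    using measurable_compose[OF Km measurable_distr_prob_space[OF f]] .
  fix A B assume A: "A \<in> sets S" and B: "B \<in> sets U"
  have "emeasure M {\<omega> \<in> space M. X \<omega> \<in> A \<and> Z \<omega> \<in> B} =
      emeasure M {\<omega> \<in> space M. X \<omega> \<in> A \<and> Y \<omega> \<in> f -` B \<inter> space T}"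
    using Z measurable_space[OF Y] by (intro arg_cong[where f = "emeasure M"]) auto
  also have "\<dots> = (\<integral>\<^sup>+x. emeasure (K x) (f -` B \<inter> space T) * indicator A x \<partial>distr M S X)"
    using K A measurable_sets[OF f B] unfolding is_cond_dist_def by blast
  also have "\<dots> = (\<integral>\<^sup>+x. emeasure (distr (K x) U f) B * indicator A x \<partial>distr M S X)"
  proof (rule nn_integral_cong)
    fix x assume "x \<in> space (distr M S X)"
    then have "sets (K x) = sets T"
      using measurable_space[OF Km, of x] by (simp add: space_prob_algebra)
    then have "f \<in> K x \<rightarrow>\<^sub>M U" "space (K x) = space T"
      using f measurable_cong_sets[of "K x" T U U] sets_eq_imp_space_eq by blast+
    then show "emeasure (K x) (f -` B \<inter> space T) * indicator A x =
        emeasure (distr (K x) U f) B * indicator A x"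
      using B by (simp add: emeasure_distr)
  qed
  finally show "emeasure M {\<omega> \<in> space M. X \<omega> \<in> A \<and> Z \<omega> \<in> B} =
      (\<integral>\<^sup>+x. emeasure (distr (K x) U f) B * indicator A x \<partial>distr M S X)" .
qed

text \<open>Each member is a coordinate projection of the joint map, which is measurable for the
  algebra it generates.\<close>

lemma measurable_vimage_algebra_restrict:
  assumes X: "\<And>j. j \<in> J \<Longrightarrow> X j \<in> M \<rightarrow>\<^sub>M N" and "i \<in> J"
  shows "X i \<in> vimage_algebra (space M) (\<lambda>\<omega>. \<lambda>j\<in>J. X j \<omega>) (\<Pi>\<^sub>M j\<in>J. N) \<rightarrow>\<^sub>M N"
proof -
  have "(\<lambda>\<omega>. \<lambda>j\<in>J. X j \<omega>) \<in> M \<rightarrow>\<^sub>M (\<Pi>\<^sub>M j\<in>J. N)"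
    using X by (intro measurable_restrict)
  then have "(\<lambda>\<omega>. \<lambda>j\<in>J. X j \<omega>) \<in>
      vimage_algebra (space M) (\<lambda>\<omega>. \<lambda>j\<in>J. X j \<omega>) (\<Pi>\<^sub>M j\<in>J. N) \<rightarrow>\<^sub>M (\<Pi>\<^sub>M j\<in>J. N)"
    by (intro measurable_vimage_algebra1) (auto dest: measurable_space)
  from measurable_compose[OF this measurable_component_singleton[OF \<open>i \<in> J\<close>]] \<open>i \<in> J\<close>
  show ?thesis
    by simp
qed

section \<open>The conditional law of the next arm along a run\<close>

lemma qcare_run_is_cond_dist:
  assumes N: "N \<ge> 1" and t: "t \<ge> 1" and run: "qcare_run M N \<alpha> r \<epsilon> a"
  shows "is_cond_dist M (history_space N t) (history r a t) (count_space (arms N)) (a t)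
    (qcare_next N \<alpha> t)"
proof -
  interpret prob_space M
    using run by (simp add: qcare_run_def)
  define X where "X = (\<lambda>(i, l). \<epsilon> i l)"
  define Y where "Y = (\<lambda>(i, l). r i l)"
  define P where "P = arms N \<times> {1 :: nat..}"
  define now where "now = arms N \<times> {t}"
  define past where "past = arms N \<times> {1..<t}"
  define W where "W = (\<lambda>\<omega>. \<lambda>i\<in>arms N. \<epsilon> i t \<omega>)"
  define \<F> where "\<F> = (\<lambda>J. vimage_algebra (space M) (\<lambda>\<omega>. \<lambda>j\<in>J. X j \<omega>) (\<Pi>\<^sub>M j\<in>J. borel))"
  define \<R> where "\<R> = vimage_algebra (space M) (\<lambda>\<omega>. \<lambda>p\<in>P. Y p \<omega>) (\<Pi>\<^sub>M p\<in>P. reward_space)"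
  have sub: "now \<subseteq> P" "past \<subseteq> P" "now \<inter> past = {}"
    using t by (auto simp: now_def past_def P_def)
  have indX: "indep_vars (\<lambda>_. borel) X P"
    using run by (simp add: qcare_run_def X_def P_def)
  have indXY: "indep_var (\<Pi>\<^sub>M p\<in>P. borel) (\<lambda>\<omega>. \<lambda>p\<in>P. X p \<omega>)
      (\<Pi>\<^sub>M p\<in>P. reward_space) (\<lambda>\<omega>. \<lambda>p\<in>P. Y p \<omega>)"
    using run by (simp add: qcare_run_def X_def Y_def P_def case_prod_beta')
  have Xm: "X p \<in> borel_measurable M" if "p \<in> P" for p
    using indX that by (auto simp: indep_vars_def)
  have Ym: "Y p \<in> M \<rightarrow>\<^sub>M reward_space" if "p \<in> P" for p
    using run that by (auto simp: qcare_run_def Y_def P_def)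
  have a: "a l \<omega> = arg_max_on (qcare_theta \<alpha> l (history r a l \<omega>) (\<lambda>i. \<epsilon> i l \<omega>)) (arms N)"
    if "l \<ge> 1" "\<omega> \<in> space M" for l \<omega>
    using run that by (simp add: qcare_run_def)

  have space_\<F>: "space (\<F> J) = space M" for J
    by (simp add: \<F>_def)
  have space_\<R>: "space \<R> = space M"
    by (simp add: \<R>_def)
  have XF: "X p \<in> borel_measurable (\<F> J)" if "p \<in> J" "J \<subseteq> P" for p J
    unfolding \<F>_def using Xm that by (intro measurable_vimage_algebra_restrict) auto
  have YR: "Y p \<in> \<R> \<rightarrow>\<^sub>M reward_space" if "p \<in> P" for p
    unfolding \<R>_def using Ym that by (intro measurable_vimage_algebra_restrict)
  \<comment> \<open>Events of present and of past noise thus both lie in \<open>\<F> P\<close>, and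
    so do their intersections, as \<open>indep_set_sigma_sets_Int\<close> demands.\<close>
  have F_mono: "sets (\<F> J) \<subseteq> sets (\<F> P)" if "J \<subseteq> P" for J
  proof -
    have "(\<lambda>\<omega>. \<lambda>j\<in>J. X j \<omega>) \<in> \<F> P \<rightarrow>\<^sub>M (\<Pi>\<^sub>M j\<in>J. borel)"
      using that by (intro measurable_restrict XF) auto
    from sets_vimage_algebra_subset[OF this] show ?thesis
      by (simp add: \<F>_def)
  qed
  have ind1: "indep_set (sets (\<F> now)) (sets (\<F> past))"
    using indep_var_restrict[OF indX sub(3,1,2)]
    by (simp add: indep_var_eq \<F>_def sets_vimage_algebra)
  have ind2: "indep_set (sets (\<F> P)) (sets \<R>)"
    using indXY by (simp add: indep_var_eq \<F>_def \<R>_def sets_vimage_algebra)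

  text \<open>The history at time \<open>t\<close> is measurable with respect to the algebra \<open>H\<close> generated by the
    rewards and the noise before \<open>t\<close>, which is independent of the noise at time \<open>t\<close>.\<close>
  define G where "G = {b \<inter> c |b c. b \<in> sets (\<F> past) \<and> c \<in> sets \<R>}"
  define H where "H = sigma (space M) G"
  have G: "G \<subseteq> Pow (space M)"
    using sets.sets_into_space[of _ "\<F> past"] by (auto simp: G_def space_\<F>)
  then have sets_H: "sets H = sigma_sets (space M) G" and space_H: "space H = space M"
    by (simp_all add: H_def)
  have "indep_set (sigma_sets (space M) (sets (\<F> now))) (sigma_sets (space M) G)"
    unfolding G_def using F_mono sub
    by (intro indep_set_sigma_sets_Int[OF _ _ _ ind1 ind2] sets.Int_stable) auto
  then have indH: "indep_set (sets (\<F> now)) (sets H)"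
    using sets.sigma_sets_eq[of "\<F> now"] by (simp add: sets_H space_\<F>)
  \<comment> \<open>Intersecting with the whole space from the other family puts each of the two
    families into \<open>G\<close>.\<close>
  have "b \<in> G" if "b \<in> sets (\<F> past)" for b
    using that sets.sets_into_space[OF that] sets.top[of \<R>] unfolding G_def space_\<F> space_\<R> by blast
  then have FH: "sets (\<F> past) \<subseteq> sets H"
    by (auto simp: sets_H)
  have "c \<in> G" if "c \<in> sets \<R>" for c
    using that sets.sets_into_space[OF that] sets.top[of "\<F> past"] unfolding G_def space_\<F> space_\<R> by blast
  then have RH: "sets \<R> \<subseteq> sets H"
    by (auto simp: sets_H)

  have \<epsilon>m: "\<epsilon> i l \<in> borel_measurable M" if "i \<in> arms N" "l \<ge> 1" for i l
    using Xm[of "(i, l)"] that by (simp add: X_def P_def)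
  have rm: "r i l \<in> M \<rightarrow>\<^sub>M reward_space" if "i \<in> arms N" "l \<ge> 1" for i l
    using Ym[of "(i, l)"] that by (simp add: Y_def P_def)
  have histm: "history r a t \<in> M \<rightarrow>\<^sub>M history_space N t"
    by (rule measurable_history[OF N _ _ a]) (simp_all add: \<epsilon>m rm)
  \<comment> \<open>The same induction is run over \<open>H\<close> in place of \<open>M\<close>:
    only rewards and noise before \<open>t\<close> enter.\<close>
  have histH: "history r a t \<in> H \<rightarrow>\<^sub>M history_space N t"
  proof (rule measurable_history[OF N _ _ a])
    fix i l assume "i \<in> arms N" "l \<in> {1..<t}"
    then have "(i, l) \<in> past"
      by (simp add: past_def)
    with sub have X: "X (i, l) \<in> borel_measurable (\<F> past)"
      and Y: "Y (i, l) \<in> \<R> \<rightarrow>\<^sub>M reward_space"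
      by (auto intro: XF YR)
    show "r i l \<in> H \<rightarrow>\<^sub>M reward_space"
      using measurable_mono[OF order_refl refl RH] Y by (auto simp: Y_def space_H space_\<R>)
    show "\<epsilon> i l \<in> borel_measurable H"
      using measurable_mono[OF order_refl refl FH] X by (auto simp: X_def space_H space_\<F>)
  qed (simp_all add: space_H)
  have Wm: "W \<in> M \<rightarrow>\<^sub>M (\<Pi>\<^sub>M i\<in>arms N. borel)"
    unfolding W_def using \<epsilon>m t by (intro measurable_restrict)
  have WF: "W \<in> \<F> now \<rightarrow>\<^sub>M (\<Pi>\<^sub>M i\<in>arms N. borel)"
    unfolding W_def
  proof (rule measurable_restrict)
    fix i assume "i \<in> arms N"
    then show "\<epsilon> i t \<in> borel_measurable (\<F> now)"
      using XF[of "(i, t)" now] sub by (simp add: X_def now_def)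
  qed
  \<comment> \<open>Independence passes to the sub-algebras generated by the history inside
    \<open>H\<close> and by \<open>W\<close> inside \<open>\<F> now\<close>, with the order
    exchanged.\<close>
  have "indep_set (sets (vimage_algebra (space M) (history r a t) (history_space N t)))
      (sets (vimage_algebra (space M) W (\<Pi>\<^sub>M i\<in>arms N. borel)))"
    using sets_vimage_algebra_subset[OF histH] sets_vimage_algebra_subset[OF WF] indH
    unfolding indep_sets2_eq space_H space_\<F> by (metis Int_commute mult.commute subset_iff)
  then have ind: "distr M (history_space N t) (history r a t) \<Otimes>\<^sub>M distr M (\<Pi>\<^sub>M i\<in>arms N. borel) W =
      distr M (history_space N t \<Otimes>\<^sub>M (\<Pi>\<^sub>M i\<in>arms N. borel)) (\<lambda>\<omega>. (history r a t \<omega>, W \<omega>))"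
    using histm Wm by (rule distr_Pair_indep_set)
  have X_law: "distr M borel (X p) = normal_dist 0 1" if "p \<in> P" for p
  proof -
    have "distributed M lborel (X p) std_normal_density"
      using run that by (auto simp: qcare_run_def X_def P_def)
    then show ?thesis
      by (simp add: distributed_def normal_dist_def cong: distr_cong)
  qed
  have "now \<noteq> {}"
    using N by (simp add: now_def)
  then have "distr M (\<Pi>\<^sub>M p\<in>now. borel) (\<lambda>\<omega>. \<lambda>p\<in>now. X p \<omega>) = (\<Pi>\<^sub>M p\<in>now. distr M borel (X p))"
    using indep_vars_subset[OF indX sub(1)] Xm sub
    by (subst indep_vars_iff_distr_eq_PiM'[symmetric]) auto
  also have "\<dots> = (\<Pi>\<^sub>M p\<in>now. normal_dist 0 1)"
    using X_law sub by (intro PiM_cong) auto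
  finally have now_law: "distr M (\<Pi>\<^sub>M p\<in>now. borel) (\<lambda>\<omega>. \<lambda>p\<in>now. X p \<omega>) =
      (\<Pi>\<^sub>M p\<in>now. normal_dist 0 1)" .
  \<comment> \<open>The independent noise at time \<open>t\<close> is indexed by the pairs
    \<open>(i, t)\<close>; relabelling them by \<open>i\<close> gives the law of
    \<open>W\<close>.\<close>
  have "(\<Pi>\<^sub>M i\<in>arms N. normal_dist 0 1) =
      distr (\<Pi>\<^sub>M p\<in>now. normal_dist 0 1) (\<Pi>\<^sub>M i\<in>arms N. normal_dist 0 1)
        (\<lambda>e. \<lambda>i\<in>arms N. e (i, t))"
    by (rule distr_PiM_reindex[symmetric])
      (auto simp: now_def inj_on_def intro: prob_space_normal_dist)
  also have "\<dots> = distr (\<Pi>\<^sub>M p\<in>now. normal_dist 0 1) (\<Pi>\<^sub>M i\<in>arms N. borel)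
        (\<lambda>e. \<lambda>i\<in>arms N. e (i, t))"
    by (intro distr_cong refl sets_PiM_cong) simp_all
  also have "\<dots> = distr M (\<Pi>\<^sub>M i\<in>arms N. borel)
      ((\<lambda>e. \<lambda>i\<in>arms N. e (i, t)) \<circ> (\<lambda>\<omega>. \<lambda>p\<in>now. X p \<omega>))"
    unfolding now_law[symmetric] using Xm sub
    by (intro distr_distr measurable_restrict measurable_component_singleton) (auto simp: now_def)
  also have "(\<lambda>e. \<lambda>i\<in>arms N. e (i, t)) \<circ> (\<lambda>\<omega>. \<lambda>p\<in>now. X p \<omega>) = W"
    by (auto simp: W_def now_def X_def fun_eq_iff)
  finally have W_law: "distr M (\<Pi>\<^sub>M i\<in>arms N. borel) W = (\<Pi>\<^sub>M i\<in>arms N. normal_dist 0 1)" ..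
  have "is_cond_dist M (history_space N t) (history r a t) (count_space (arms N)) (a t)
      (\<lambda>h. distr (distr M (\<Pi>\<^sub>M i\<in>arms N. borel) W) (count_space (arms N))
        (\<lambda>e. arg_max_on (qcare_theta \<alpha> t h e) (arms N)))"
    by (rule is_cond_dist_indep[OF histm Wm ind measurable_qcare_arm[OF N]])
      (simp only: a[OF t] W_def arg_max_on_qcare_theta_restrict)
  then show ?thesis
    unfolding W_law qcare_next_def[abs_def] .
qed

text \<open>A Thompson run prescribes the conditional law of the sample vector, so it only remains
  to push that law through the arg max.\<close>

lemma gts_run_is_cond_dist:
  assumes N: "N \<ge> 1" and t: "t \<ge> 1" and run: "gts_run M N r \<theta> a"
  shows "is_cond_dist M (history_space N t) (history r a t) (count_space (arms N)) (a t) (gts_next N t)"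
proof -
  have K: "is_cond_dist M (history_space N t) (history r a t)
      (\<Pi>\<^sub>M i\<in>arms N. borel) (\<lambda>\<omega>. \<lambda>i\<in>arms N. \<theta> i t \<omega>) (gts_sample N t)"
    using run t by (simp add: gts_run_def)
  have "(\<lambda>x :: nat \<Rightarrow> real. arg_max_on x (arms N)) \<in> (\<Pi>\<^sub>M i\<in>arms N. borel) \<rightarrow>\<^sub>M count_space (arms N)"
    using N by (intro measurable_arg_max_on) auto
  moreover have "a t \<omega> = arg_max_on (\<lambda>i\<in>arms N. \<theta> i t \<omega>) (arms N)" if "\<omega> \<in> space M" for \<omega>
    using run t that by (simp add: gts_run_def)
  ultimately show ?thesis
    unfolding gts_next_def[abs_def] by (rule is_cond_dist_compose[OF K])
qed

theorem proposition1:
  fixes N :: nat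
  assumes "N \<ge> 1"
  shows "\<forall>t\<ge>1.
    (\<forall>h\<in>space (history_space N t). qcare_next N (1/2) t h = gts_next N t h) \<and>
    (\<forall>(M :: 'a measure) r \<epsilon> a. qcare_run M N (1/2) r \<epsilon> a \<longrightarrow>
       is_cond_dist M (history_space N t) (history r a t) (count_space (arms N)) (a t)
         (qcare_next N (1/2) t)) \<and>
    (\<forall>(M :: 'b measure) r \<theta> a. gts_run M N r \<theta> a \<longrightarrow>
       is_cond_dist M (history_space N t) (history r a t) (count_space (arms N)) (a t)
         (gts_next N t))"
  by (intro allI impI conjI ballI qcare_next_eq_gts_next qcare_run_is_cond_dist
      gts_run_is_cond_dist assms)

end
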